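(* Let $B$ be a skew left brace and let $x\in B$. Let $A=B(x)$ be the smallest sub skew left brace of $B$ containing $x$. Let $(A,r_A)$ be the solution associated to the skew left brace $A$ and let $X$ be the orbit of $x$ in $(A,r_A)$. Then $(X,r_A|_{X\times X})$ is indecomposable.
   Context: A skew left brace is a triple $(A,+,\circ)$ where $(A,+)$ and $(A,\circ)$ are (not necessarily abelian) groups such that $a\circ(b+c)=a\circ b-a+a\circ c$ for all $a,b,c\in A$. A sub skew left brace is a subset that is a subgroup of both groups. Write $a'$ for the inverse of $a$ in $(A,\circ)$ and $\lambda_a(b)=-a+a\circ b$. A set-theoretic solution of the Yang--Baxter equation is a pair $(X,r)$ with $X$ a set and $r\colon X\times X\to X\times X$ a map satisfying $(r\times\mathrm{id})(\mathrm{id}\times r)(r\times\mathrm{id})=(\mathrm{id}\times r)(r\times\mathrm{id})(\mathrm{id}\times r)$; writing $r(x,y)=(\sigma_x(y),\tau_y(x))$, it is non-degenerate if all $\sigma_x$ and $\tau_x$ are permutations of $X$. The solution associated to a skew left brace $A$ is $(A,r_A)$ with $r_A(a,b)=(\sigma_a(b),\tau_b(a))$, $\sigma_a(b)=\lambda_a(b)$, $\tau_b(a)=\lambda_a(b)'\circ a\circ b$; it is a non-degenerate solution. For a non-degenerate solution $(X,r)$, the orbit of $z\in X$ is the smallest subset $Y\subseteq X$ with $z\in Y$ and $\sigma_x(y),\sigma_x^{-1}(y),\tau_x(y),\tau_x^{-1}(y)\in Y$ for all $y\in Y$, $x\in X$ (equivalently, the orbit of $z$ under the group of permutations of $X$ generated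 by all $\sigma_x,\tau_x$). The restriction of $r$ to an orbit is again a non-degenerate solution. A non-degenerate solution $(X,r)$ is decomposable if there are disjoint non-empty subsets $X_1,X_2$ of $X$ with $X=X_1\cup X_2$ and $r(X_i\times X_j)=X_j\times X_i$ for all $i,j\in\{1,2\}$; otherwise it is indecomposable. *)

theory Defs
  imports "HOL-Algebra.Ring"
begin

text \<open>
  A skew left brace is encoded as a record of ring type: \<open>\<oplus>\<close>, \<open>\<ominus>\<close>, \<open>\<zero>\<close> belong to the group \<open>(A,+)\<close>
  (which need not be abelian) and \<open>\<otimes>\<close>, \<open>inv\<close>, \<open>\<one>\<close> to the group \<open>(A,\<circ>)\<close>; no ring axioms are assumed.
\<close>

locale skew_left_brace = add: group "add_monoid A" + circ: group A for A (structure) +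
  assumes brace_distrib:
    "\<lbrakk>a \<in> carrier A; b \<in> carrier A; c \<in> carrier A\<rbrakk>
      \<Longrightarrow> a \<otimes> (b \<oplus> c) = (a \<otimes> b \<ominus> a) \<oplus> a \<otimes> c"

definition sub_skew_left_brace :: "'a set \<Rightarrow> ('a, 'm) ring_scheme \<Rightarrow> bool" where
  "sub_skew_left_brace S A \<longleftrightarrow> subgroup S (add_monoid A) \<and> subgroup S A"

definition gen_brace_carrier :: "('a, 'm) ring_scheme \<Rightarrow> 'a \<Rightarrow> 'a set" where
  "gen_brace_carrier A x = \<Inter>{S. sub_skew_left_brace S A \<and> x \<in> S}"

definition gen_brace :: "('a, 'm) ring_scheme \<Rightarrow> 'a \<Rightarrow> ('a, 'm) ring_scheme" where
  "gen_brace A x = A\<lparr>carrier := gen_brace_carrier A x\<rparr>"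

lemma (in skew_left_brace) gen_brace_carrier_least:
  assumes "x \<in> carrier A"
  shows "sub_skew_left_brace (gen_brace_carrier A x) A"
    and "x \<in> gen_brace_carrier A x"
    and "\<And>S. \<lbrakk>sub_skew_left_brace S A; x \<in> S\<rbrakk> \<Longrightarrow> gen_brace_carrier A x \<subseteq> S"
proof -
  let ?F = "{S. sub_skew_left_brace S A \<and> x \<in> S}"
  have "carrier A \<in> ?F"
    using assms circ.subgroup_self add.subgroup_self
    by (simp add: sub_skew_left_brace_def)
  then have ne: "?F \<noteq> {}" by blast
  have "subgroup (\<Inter>?F) (add_monoid A)"
    by (rule add.subgroups_Inter) (use ne in \<open>auto simp: sub_skew_left_brace_def\<close>)
  moreover have "subgroup (\<Inter>?F) A"
    by (rule circ.subgroups_Inter) (use ne in \<open>auto simp: sub_skew_left_brace_def\<close>)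
  ultimately show "sub_skew_left_brace (gen_brace_carrier A x) A"
    by (simp add: sub_skew_left_brace_def gen_brace_carrier_def)
qed (auto simp: gen_brace_carrier_def)

definition brace_lambda :: "('a, 'm) ring_scheme \<Rightarrow> 'a \<Rightarrow> 'a \<Rightarrow> 'a" where
  "brace_lambda A a b = (\<ominus>\<^bsub>A\<^esub> a) \<oplus>\<^bsub>A\<^esub> (a \<otimes>\<^bsub>A\<^esub> b)"

definition brace_solution :: "('a, 'm) ring_scheme \<Rightarrow> 'a \<times> 'a \<Rightarrow> 'a \<times> 'a" where
  "brace_solution A =
    (\<lambda>(a, b). (brace_lambda A a b, inv\<^bsub>A\<^esub> (brace_lambda A a b) \<otimes>\<^bsub>A\<^esub> a \<otimes>\<^bsub>A\<^esub> b))"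


text \<open>
  A solution is a set \<open>X\<close> together with a map \<open>r\<close> on all pairs of the type; only the values of \<open>r\<close>
  on \<open>X \<times> X\<close> matter.
\<close>

definition act_12 :: "('a \<times> 'a \<Rightarrow> 'a \<times> 'a) \<Rightarrow> 'a \<times> 'a \<times> 'a \<Rightarrow> 'a \<times> 'a \<times> 'a" where
  "act_12 r = (\<lambda>(x, y, z). (fst (r (x, y)), snd (r (x, y)), z))"

definition act_23 :: "('a \<times> 'a \<Rightarrow> 'a \<times> 'a) \<Rightarrow> 'a \<times> 'a \<times> 'a \<Rightarrow> 'a \<times> 'a \<times> 'a" where
  "act_23 r = (\<lambda>(x, y, z). (x, r (y, z)))"

definition yb_solution :: "'a set \<Rightarrow> ('a \<times> 'a \<Rightarrow> 'a \<times> 'a) \<Rightarrow> bool" where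
  "yb_solution X r \<longleftrightarrow> r \<in> X \<times> X \<rightarrow> X \<times> X \<and>
    (\<forall>t \<in> X \<times> X \<times> X. act_12 r (act_23 r (act_12 r t)) = act_23 r (act_12 r (act_23 r t)))"

text \<open>Note the argument order of \<open>\<tau>\<close>: \<open>r(x,y) = (\<sigma>\<^sub>x(y), \<tau>\<^sub>y(x))\<close>.\<close>

definition sol_sigma :: "('a \<times> 'a \<Rightarrow> 'a \<times> 'a) \<Rightarrow> 'a \<Rightarrow> 'a \<Rightarrow> 'a" where
  "sol_sigma r x y = fst (r (x, y))"

definition sol_tau :: "('a \<times> 'a \<Rightarrow> 'a \<times> 'a) \<Rightarrow> 'a \<Rightarrow> 'a \<Rightarrow> 'a" where
  "sol_tau r y x = snd (r (x, y))"

definition nondegenerate_solution :: "'a set \<Rightarrow> ('a \<times> 'a \<Rightarrow> 'a \<times> 'a) \<Rightarrow> bool" where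
  "nondegenerate_solution X r \<longleftrightarrow> yb_solution X r \<and>
    (\<forall>x\<in>X. bij_betw (sol_sigma r x) X X \<and> bij_betw (sol_tau r x) X X)"

inductive_set sol_orbit :: "'a set \<Rightarrow> ('a \<times> 'a \<Rightarrow> 'a \<times> 'a) \<Rightarrow> 'a \<Rightarrow> 'a set"
  for X r z where
  base: "z \<in> sol_orbit X r z"
| sigma: "\<lbrakk>y \<in> sol_orbit X r z; x \<in> X\<rbrakk> \<Longrightarrow> sol_sigma r x y \<in> sol_orbit X r z"
| sigma_inv: "\<lbrakk>y \<in> sol_orbit X r z; x \<in> X\<rbrakk> \<Longrightarrow> inv_into X (sol_sigma r x) y \<in> sol_orbit X r z"
| tau: "\<lbrakk>y \<in> sol_orbit X r z; x \<in> X\<rbrakk> \<Longrightarrow> sol_tau r x y \<in> sol_orbit X r z"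
| tau_inv: "\<lbrakk>y \<in> sol_orbit X r z; x \<in> X\<rbrakk> \<Longrightarrow> inv_into X (sol_tau r x) y \<in> sol_orbit X r z"

lemma sol_orbit_subset:
  assumes "nondegenerate_solution X r" "z \<in> X"
  shows "sol_orbit X r z \<subseteq> X"
proof
  fix y assume "y \<in> sol_orbit X r z"
  then show "y \<in> X"
    by induction
      (use assms in \<open>auto simp: nondegenerate_solution_def
        intro: bij_betw_apply[of _ X X] bij_betw_apply[OF bij_betw_inv_into]\<close>)
qed

definition decomposable :: "'a set \<Rightarrow> ('a \<times> 'a \<Rightarrow> 'a \<times> 'a) \<Rightarrow> bool" where
  "decomposable X r \<longleftrightarrow>
    (\<exists>X\<^sub>1 X\<^sub>2. X\<^sub>1 \<noteq> {} \<and> X\<^sub>2 \<noteq> {} \<and> X\<^sub>1 \<inter> X\<^sub>2 = {} \<and> X = X\<^sub>1 \<union> X\<^sub>2 \<and>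
      (\<forall>P \<in> {X\<^sub>1, X\<^sub>2}. \<forall>Q \<in> {X\<^sub>1, X\<^sub>2}. r ` (P \<times> Q) = Q \<times> P))"

text \<open>Being a non-degenerate solution is part of being indecomposable.\<close>

definition indecomposable_solution :: "'a set \<Rightarrow> ('a \<times> 'a \<Rightarrow> 'a \<times> 'a) \<Rightarrow> bool" where
  "indecomposable_solution X r \<longleftrightarrow> nondegenerate_solution X r \<and> \<not> decomposable X r"

end

theory Submission
  imports Defs "HOL-Algebra.Generated_Groups"
begin

text \<open>
  For a skew left brace, \<open>\<lambda>\<close> is a left and \<open>\<tau>\<close> a right action of \<open>(A,\<circ>)\<close> on \<open>A\<close>, with
  \<open>a \<circ> b = \<lambda>\<^sub>a(b) \<circ> \<tau>\<^sub>b(a)\<close> and \<open>\<lambda>\<^sub>a(b \<circ> c) = \<lambda>\<^sub>a(b) \<circ> \<lambda>\<^sub>d(c)\<close> where \<open>d = \<tau>\<^sub>b(a)\<close>. By the last identity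
  the subgroup of \<open>(A,\<circ>)\<close> generated by a \<open>\<lambda>\<close>-invariant set \<open>X\<close> is itself \<open>\<lambda>\<close>-invariant. It is then
  also an additive subgroup, as \<open>a + b = a \<circ> \<lambda>\<^sub>a\<^sup>-\<^sup>1(b)\<close> and \<open>-a = \<lambda>\<^sub>a(a')\<close>. Hence, if \<open>A\<close> is generated
  by \<open>x\<close> as a skew left brace, then the orbit \<open>X\<close> of \<open>x\<close> generates the group \<open>(A,\<circ>)\<close>. Given a decomposition
  \<open>X = X\<^sub>1 \<union> X\<^sub>2\<close>, the elements of \<open>A\<close> whose \<open>\<lambda>\<close> and \<open>\<tau>\<close> preserve both parts form a
  subgroup of \<open>(A,\<circ>)\<close> containing \<open>X\<close>, so all of \<open>A\<close> preserves both parts. As \<open>X\<close> is a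
  single orbit, one of the parts is empty.
\<close>

section \<open>Restriction of a solution to an orbit\<close>

text \<open>An orbit is closed under all \<sigma>, \<tau> and their inverses, so these bijections of
  \<open>X\<close> restrict to bijections of \<open>Y\<close>. The braid relation is inherited
  because every intermediate triple stays in \<open>Y \<times> Y \<times> Y\<close>, where
  \<open>r\<close> and its restriction agree.\<close>

lemma nondegenerate_solution_sol_orbit:
  assumes nd: "nondegenerate_solution X r" and z: "z \<in> X"
  defines "Y \<equiv> sol_orbit X r z"
  shows "nondegenerate_solution Y (restrict r (Y \<times> Y))"
proof -
  let ?s = "restrict r (Y \<times> Y)"
  have YX: "Y \<subseteq> X"
    unfolding Y_def by (rule sol_orbit_subset[OF nd z])
  have closed: "fst (r (a, b)) \<in> Y" "snd (r (a, b)) \<in> Y" if "a \<in> Y" "b \<in> Y" for a b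
    using sol_orbit.sigma[of b X r z a] sol_orbit.tau[of a X r z b] that YX
    by (auto simp: Y_def sol_sigma_def sol_tau_def)
  have "?s \<in> Y \<times> Y \<rightarrow> Y \<times> Y"
    using closed by (auto simp: mem_Times_iff)
  moreover have "act_12 ?s (act_23 ?s (act_12 ?s t)) = act_23 ?s (act_12 ?s (act_23 ?s t))"
    if "t \<in> Y \<times> Y \<times> Y" for t
  proof -
    have res: "act_12 ?s u = act_12 r u" "act_23 ?s u = act_23 r u"
      "act_12 r u \<in> Y \<times> Y \<times> Y" "act_23 r u \<in> Y \<times> Y \<times> Y" if "u \<in> Y \<times> Y \<times> Y" for u
      using that closed by (cases u; auto simp: act_12_def act_23_def mem_Times_iff)+
    have "act_12 r (act_23 r (act_12 r t)) = act_23 r (act_12 r (act_23 r t))"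
      using nd that YX by (auto simp: nondegenerate_solution_def yb_solution_def subset_iff)
    then show ?thesis
      by (simp add: res that)
  qed
  moreover have "bij_betw (sol_sigma ?s a) Y Y \<and> bij_betw (sol_tau ?s a) Y Y" if a: "a \<in> Y" for a
  proof -
    have aX: "a \<in> X"
      using a YX by blast
    have bij: "bij_betw f Y Y"
      if "bij_betw f X X" "f ` Y \<subseteq> Y" "inv_into X f ` Y \<subseteq> Y" for f
    proof -
      have "b \<in> f ` Y" if "b \<in> Y" for b
      proof
        show "b = f (inv_into X f b)"
          using \<open>bij_betw f X X\<close> that YX by (metis bij_betw_inv_into_right subsetD)
        show "inv_into X f b \<in> Y"
          using \<open>inv_into X f ` Y \<subseteq> Y\<close> that by blast
      qed
      then show ?thesis
        using that YX by (auto simp: bij_betw_def intro: inj_on_subset)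
    qed
    have "bij_betw (sol_sigma r a) Y Y" "bij_betw (sol_tau r a) Y Y"
      using nd aX
      by (intro bij; auto simp: nondegenerate_solution_def Y_def intro: sol_orbit.intros)+
    moreover have "sol_sigma ?s a b = sol_sigma r a b" "sol_tau ?s a b = sol_tau r a b"
      if "b \<in> Y" for b
      using a that by (auto simp: sol_sigma_def sol_tau_def)
    ultimately show ?thesis
      by (simp cong: bij_betw_cong)
  qed
  ultimately show ?thesis
    by (auto simp: nondegenerate_solution_def yb_solution_def)
qed

section \<open>The actions \<lambda> and \<tau> of a skew left brace\<close>

context skew_left_brace
begin

abbreviation lam :: "'a \<Rightarrow> 'a \<Rightarrow> 'a" where
  "lam \<equiv> brace_lambda A"

text \<open>This is \<open>\<tau>\<^sub>b(a)\<close>; the index comes first so that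
  \<open>rho b\<close> is itself the map by which \<open>b\<close> acts.\<close>

definition rho :: "'a \<Rightarrow> 'a \<Rightarrow> 'a" where
  "rho b a = inv (lam a b) \<otimes> a \<otimes> b"

lemma brace_solution_eq: "brace_solution A (a, b) = (lam a b, rho b a)"
  by (simp add: brace_solution_def rho_def)

lemma sol_sigma_brace_solution: "sol_sigma (brace_solution A) = lam"
  by (simp add: sol_sigma_def brace_solution_eq fun_eq_iff)

lemma sol_tau_brace_solution: "sol_tau (brace_solution A) = rho"
  by (simp add: sol_tau_def brace_solution_eq fun_eq_iff)

lemma add_closed [simp]: "a \<in> carrier A \<Longrightarrow> b \<in> carrier A \<Longrightarrow> a \<oplus> b \<in> carrier A"
  using add.m_closed by simp

lemma a_inv_closed [simp]: "a \<in> carrier A \<Longrightarrow> \<ominus> a \<in> carrier A"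
  using add.inv_closed by (simp add: a_inv_def)

lemma zero_closed [simp]: "\<zero> \<in> carrier A"
  using add.one_closed by simp

lemma add_assoc:
  "a \<in> carrier A \<Longrightarrow> b \<in> carrier A \<Longrightarrow> c \<in> carrier A \<Longrightarrow> a \<oplus> b \<oplus> c = a \<oplus> (b \<oplus> c)"
  using add.m_assoc by simp

lemma add_zero [simp]: "a \<in> carrier A \<Longrightarrow> a \<oplus> \<zero> = a" "a \<in> carrier A \<Longrightarrow> \<zero> \<oplus> a = a"
  using add.r_one add.l_one by simp_all

lemma add_neg [simp]: "a \<in> carrier A \<Longrightarrow> a \<oplus> \<ominus> a = \<zero>" "a \<in> carrier A \<Longrightarrow> \<ominus> a \<oplus> a = \<zero>"
  using add.r_inv add.l_inv by (simp_all add: a_inv_def)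

lemma add_neg_cancel [simp]:
  assumes "a \<in> carrier A" "b \<in> carrier A"
  shows "a \<oplus> (\<ominus> a \<oplus> b) = b" "\<ominus> a \<oplus> (a \<oplus> b) = b"
  using assms by (simp_all flip: add_assoc)

lemma lam_closed [simp]: "a \<in> carrier A \<Longrightarrow> b \<in> carrier A \<Longrightarrow> lam a b \<in> carrier A"
  by (simp add: brace_lambda_def)

lemma rho_closed [simp]: "a \<in> carrier A \<Longrightarrow> b \<in> carrier A \<Longrightarrow> rho b a \<in> carrier A"
  by (simp add: rho_def)

lemma circ_eq_add_lam: "a \<in> carrier A \<Longrightarrow> b \<in> carrier A \<Longrightarrow> a \<otimes> b = a \<oplus> lam a b"
  by (simp add: brace_lambda_def)

lemma lam_add:
  assumes "a \<in> carrier A" "b \<in> carrier A" "c \<in> carrier A"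
  shows "lam a (b \<oplus> c) = lam a b \<oplus> lam a c"
  using assms by (simp add: brace_lambda_def brace_distrib a_minus_def add_assoc)

lemma zero_eq_one: "\<zero> = \<one>"
proof -
  \<comment> \<open>This instance of the brace law collapses to
    \<open>\<zero> = \<ominus> \<one>\<close>.\<close>
  have "\<one> \<otimes> (\<zero> \<oplus> \<zero>) = (\<one> \<otimes> \<zero> \<ominus> \<one>) \<oplus> \<one> \<otimes> \<zero>"
    by (rule brace_distrib) auto
  then have "\<zero> = \<ominus> \<one>"
    by (simp add: a_minus_def)
  then have "\<one> \<oplus> \<zero> = \<one> \<oplus> \<ominus> \<one>"
    by simp
  then show ?thesis
    by simp
qed

lemma lam_one_left [simp]: "b \<in> carrier A \<Longrightarrow> lam \<one> b = b"
  using add_neg_cancel(2)[of \<zero> b] by (simp add: brace_lambda_def flip: zero_eq_one) (simp add: zero_eq_one)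

lemma lam_one_right [simp]: "a \<in> carrier A \<Longrightarrow> lam a \<one> = \<one>"
  by (simp add: brace_lambda_def zero_eq_one)

text \<open>Expanding \<open>a \<otimes> b \<otimes> c\<close> in both bracketings gives the two
  sides, each with \<open>a \<otimes> b\<close> added on the left, which cancels.\<close>

lemma lam_circ:
  assumes "a \<in> carrier A" "b \<in> carrier A" "c \<in> carrier A"
  shows "lam (a \<otimes> b) c = lam a (lam b c)"
proof -
  have "(a \<otimes> b) \<oplus> lam (a \<otimes> b) c = a \<otimes> (b \<oplus> lam b c)"
    using assms by (simp flip: circ_eq_add_lam add: circ.m_assoc)
  also have "\<dots> = a \<oplus> (lam a b \<oplus> lam a (lam b c))"
    using assms by (simp add: circ_eq_add_lam[of a] lam_add)
  also have "\<dots> = (a \<otimes> b) \<oplus> lam a (lam b c)"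
    using assms by (simp add: circ_eq_add_lam[of a] add_assoc)
  finally have "\<ominus> (a \<otimes> b) \<oplus> ((a \<otimes> b) \<oplus> lam (a \<otimes> b) c) = \<ominus> (a \<otimes> b) \<oplus> ((a \<otimes> b) \<oplus> lam a (lam b c))"
    by simp
  then show ?thesis
    using assms by simp
qed

lemma lam_inv_cancel [simp]:
  assumes "a \<in> carrier A" "b \<in> carrier A"
  shows "lam a (lam (inv a) b) = b" "lam (inv a) (lam a b) = b"
  using assms by (simp_all flip: lam_circ)

lemma lam_circ_rho: "a \<in> carrier A \<Longrightarrow> b \<in> carrier A \<Longrightarrow> lam a b \<otimes> rho b a = a \<otimes> b"
  by (simp add: rho_def flip: circ.m_assoc)

text \<open>Writing \<open>b \<otimes> c\<close> as \<open>b \<oplus> lam b c\<close> makes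
  additivity of \<open>lam a\<close> applicable; factoring \<open>a \<otimes> b\<close> as
  \<open>lam a b \<otimes> rho b a\<close> turns the resulting sum back into a product.\<close>

lemma lam_circ_right:
  assumes "a \<in> carrier A" "b \<in> carrier A" "c \<in> carrier A"
  shows "lam a (b \<otimes> c) = lam a b \<otimes> lam (rho b a) c"
proof -
  have "lam a (b \<otimes> c) = lam a b \<oplus> lam (a \<otimes> b) c"
    using assms by (simp add: circ_eq_add_lam[of b] lam_add lam_circ)
  also have "lam (a \<otimes> b) c = lam (lam a b) (lam (rho b a) c)"
    using assms by (simp flip: lam_circ add: lam_circ_rho)
  finally show ?thesis
    using assms by (simp add: circ_eq_add_lam[of "lam a b"])
qed

text \<open>Inverting the product formula for \<open>lam a (b \<otimes> c)\<close> reverses its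
  factors, which puts \<open>inv (lam a b)\<close> next to \<open>a \<otimes> b\<close>, and these
  combine to \<open>rho b a\<close>.\<close>

lemma rho_circ:
  assumes "a \<in> carrier A" "b \<in> carrier A" "c \<in> carrier A"
  shows "rho (b \<otimes> c) a = rho c (rho b a)"
proof -
  have "rho (b \<otimes> c) a = inv (lam (rho b a) c) \<otimes> inv (lam a b) \<otimes> a \<otimes> (b \<otimes> c)"
    using assms by (simp add: rho_def[of "b \<otimes> c"] lam_circ_right circ.inv_mult_group)
  also have "\<dots> = inv (lam (rho b a) c) \<otimes> rho b a \<otimes> c"
    using assms by (simp add: rho_def[of b] circ.m_assoc)
  finally show ?thesis
    by (simp add: rho_def[of c])
qed

lemma rho_one [simp]: "a \<in> carrier A \<Longrightarrow> rho \<one> a = a"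
  by (simp add: rho_def)

lemma rho_inv_cancel [simp]:
  assumes "a \<in> carrier A" "b \<in> carrier A"
  shows "rho b (rho (inv b) a) = a" "rho (inv b) (rho b a) = a"
  using assms by (simp_all flip: rho_circ)

section \<open>Non-degeneracy and the braid relation\<close>

lemma bij_betw_lam: "a \<in> carrier A \<Longrightarrow> bij_betw (lam a) (carrier A) (carrier A)"
  by (rule bij_betwI[where g = "lam (inv a)"]) auto

lemma bij_betw_rho: "a \<in> carrier A \<Longrightarrow> bij_betw (rho a) (carrier A) (carrier A)"
  by (rule bij_betwI[where g = "rho (inv a)"]) auto

lemma inv_into_lam:
  assumes "a \<in> carrier A" "b \<in> carrier A"
  shows "inv_into (carrier A) (lam a) b = lam (inv a) b"
  using assms bij_betw_lam[of a] by (intro inv_into_f_eq) (auto simp: bij_betw_def)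

lemma inv_into_rho:
  assumes "a \<in> carrier A" "b \<in> carrier A"
  shows "inv_into (carrier A) (rho a) b = rho (inv a) b"
  using assms bij_betw_rho[of a] by (intro inv_into_f_eq) (auto simp: bij_betw_def)

text \<open>
  The outer components of the braid relation agree because \<open>\<lambda>\<close> and \<open>\<tau>\<close> are actions; the middle
  ones then agree because \<open>r\<close> preserves the product of the components.
\<close>

lemma yb_solution_brace_solution: "yb_solution (carrier A) (brace_solution A)"
proof -
  have "act_12 (brace_solution A) (act_23 (brace_solution A) (act_12 (brace_solution A) (a, b, c)))
      = act_23 (brace_solution A) (act_12 (brace_solution A) (act_23 (brace_solution A) (a, b, c)))"
    if abc: "a \<in> carrier A" "b \<in> carrier A" "c \<in> carrier A" for a b c
  proof -
    \<comment> \<open>The left side of the braid relation is \<open>(p, q, s)\<close>;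
      \<open>q'\<close> is the middle component of the right side.\<close>
    define p where "p = lam (lam a b) (lam (rho b a) c)"
    define q where "q = rho (lam (rho b a) c) (lam a b)"
    define q' where "q' = lam (rho (lam b c) a) (rho c b)"
    define s where "s = rho c (rho b a)"
    have carr: "p \<in> carrier A" "q \<in> carrier A" "q' \<in> carrier A" "s \<in> carrier A"
      using abc by (auto simp: p_def q_def q'_def s_def)
    have p: "p = lam a (lam b c)"
      using abc unfolding p_def by (simp flip: lam_circ add: lam_circ_rho)
    have s: "s = rho (rho c b) (rho (lam b c) a)"
      using abc unfolding s_def by (simp flip: rho_circ add: lam_circ_rho)
    have "p \<otimes> q \<otimes> s = lam a b \<otimes> (lam (rho b a) c \<otimes> s)"
      using abc by (simp add: p_def q_def s_def lam_circ_rho circ.m_assoc)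
    also have "\<dots> = lam a b \<otimes> (rho b a \<otimes> c)"
      using abc by (simp add: s_def lam_circ_rho)
    also have "\<dots> = a \<otimes> b \<otimes> c"
      using abc by (simp add: lam_circ_rho flip: circ.m_assoc)
    also have "\<dots> = a \<otimes> (lam b c \<otimes> rho c b)"
      using abc by (simp add: lam_circ_rho circ.m_assoc)
    also have "\<dots> = a \<otimes> lam b c \<otimes> rho c b"
      using abc by (simp add: circ.m_assoc)
    also have "\<dots> = p \<otimes> (rho (lam b c) a \<otimes> rho c b)"
      using abc by (simp add: p lam_circ_rho flip: circ.m_assoc)
    also have "\<dots> = p \<otimes> q' \<otimes> s"
      using abc carr by (simp add: q'_def s lam_circ_rho circ.m_assoc)
    finally have "q = q'"
      using carr by simp
    then show ?thesis
      using p s by (simp add: act_12_def act_23_def brace_solution_eq p_def q_def q'_def s_def)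
  qed
  then show ?thesis
    by (auto simp: yb_solution_def brace_solution_eq)
qed

lemma nondegenerate_brace_solution: "nondegenerate_solution (carrier A) (brace_solution A)"
  by (simp add: nondegenerate_solution_def yb_solution_brace_solution sol_sigma_brace_solution
      sol_tau_brace_solution bij_betw_lam bij_betw_rho)

section \<open>Sub skew left braces from invariant sets\<close>

lemma sub_skew_left_braceI:
  assumes G: "subgroup G A" and lam: "\<And>a b. a \<in> carrier A \<Longrightarrow> b \<in> G \<Longrightarrow> lam a b \<in> G"
  shows "sub_skew_left_brace G A"
proof -
  interpret G: subgroup G A by (rule G)
  have carr: "a \<in> carrier A" if "a \<in> G" for a
    using that G.subset by blast
  have plus: "a \<oplus> b \<in> G" if "a \<in> G" "b \<in> G" for a b
  proof -
    have "a \<otimes> lam (inv a) b \<in> G"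
      using that carr by (intro G.m_closed lam) auto
    then show ?thesis
      using that carr by (simp add: circ_eq_add_lam)
  qed
  have neg: "\<ominus> a \<in> G" if "a \<in> G" for a
  proof -
    \<comment> \<open>This element is \<open>\<ominus> a \<oplus> \<one>\<close>, hence
      \<open>\<ominus> a\<close>, since the two identities coincide.\<close>
    have "lam a (inv a) \<in> G"
      using that carr by (intro lam) auto
    then show ?thesis
      using that carr by (simp add: brace_lambda_def flip: zero_eq_one)
  qed
  have "subgroup G (add_monoid A)"
    using G.subset plus neg
    by (intro add.subgroupI) (use G.one_closed in \<open>force simp flip: a_inv_def\<close>)+
  with G show ?thesis
    by (simp add: sub_skew_left_brace_def)
qed

lemma sub_skew_left_brace_generate:
  assumes X: "X \<subseteq> carrier A" and lam: "\<And>a b. a \<in> carrier A \<Longrightarrow> b \<in> X \<Longrightarrow> lam a b \<in> X"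
  shows "sub_skew_left_brace (generate A X) A"
proof (rule sub_skew_left_braceI)
  show "subgroup (generate A X) A"
    by (rule circ.generate_is_subgroup[OF X])
  show "lam a b \<in> generate A X" if "a \<in> carrier A" "b \<in> generate A X" for a b
    \<comment> \<open>The index \<open>a\<close> must vary in the induction: in a product, the
      second factor is acted on by \<open>rho h1 a\<close> instead of \<open>a\<close>.\<close>
    using that(2,1)
  proof (induction arbitrary: a)
    case one
    then show ?case
      by (simp add: generate.one)
  next
    case (incl h)
    then show ?case
      by (simp add: lam generate.incl)
  next
    case (inv h)
    have h: "h \<in> carrier A"
      using inv X by blast
    \<comment> \<open>With this \<open>d\<close>, expanding
      \<open>lam d (h \<otimes> inv h) = \<one>\<close> makes \<open>lam a (inv h)\<close> the
      inverse of \<open>lam d h\<close>, which is known to lie in \<open>X\<close>.\<close>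
    define d where "d = rho (inv h) a"
    have d: "d \<in> carrier A" "rho h d = a"
      using h inv by (simp_all add: d_def)
    have "lam d h \<otimes> lam a (inv h) = \<one>"
      using lam_circ_right[of d h "inv h"] d h by simp
    then have "lam a (inv h) = inv (lam d h)"
      using d h inv by (metis circ.inv_closed circ.inv_equality circ.inv_inv lam_closed)
    then show ?case
      using inv d by (simp add: lam generate.inv)
  next
    case (eng h1 h2)
    have "h1 \<in> carrier A" "h2 \<in> carrier A"
      using eng.hyps circ.generate_in_carrier[OF X] by blast+
    then show ?case
      using eng by (simp add: lam_circ_right generate.eng)
  qed
qed

section \<open>Indecomposability of the orbit of a generator\<close>

theorem indecomposable_orbit:
  assumes x: "x \<in> carrier A"
    and gen: "\<And>S. sub_skew_left_brace S A \<Longrightarrow> x \<in> S \<Longrightarrow> carrier A \<subseteq> S"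
  defines "X \<equiv> sol_orbit (carrier A) (brace_solution A) x"
  shows "indecomposable_solution X (restrict (brace_solution A) (X \<times> X))"
proof -
  have xX: "x \<in> X"
    unfolding X_def by (rule sol_orbit.base)
  have XA: "X \<subseteq> carrier A"
    unfolding X_def by (rule sol_orbit_subset[OF nondegenerate_brace_solution x])
  have lamX: "lam a b \<in> X" and rhoX: "rho a b \<in> X" if "a \<in> carrier A" "b \<in> X" for a b
    using sol_orbit.sigma[of b "carrier A" "brace_solution A" x a]
      sol_orbit.tau[of b "carrier A" "brace_solution A" x a] that
    by (simp_all add: X_def sol_sigma_brace_solution sol_tau_brace_solution)
  have generate: "carrier A \<subseteq> generate A X"
    by (rule gen[OF sub_skew_left_brace_generate[OF XA lamX]]) (auto intro: xX generate.incl)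
  have "\<not> decomposable X (restrict (brace_solution A) (X \<times> X))"
  proof
    assume "decomposable X (restrict (brace_solution A) (X \<times> X))"
    then obtain X\<^sub>1 X\<^sub>2 where ne: "X\<^sub>1 \<noteq> {}" "X\<^sub>2 \<noteq> {}" and disj: "X\<^sub>1 \<inter> X\<^sub>2 = {}" and un: "X = X\<^sub>1 \<union> X\<^sub>2"
      and r: "\<forall>P \<in> {X\<^sub>1, X\<^sub>2}. \<forall>Q \<in> {X\<^sub>1, X\<^sub>2}. restrict (brace_solution A) (X \<times> X) ` (P \<times> Q) = Q \<times> P"
      unfolding decomposable_def by auto
    have swap: "lam a b \<in> Q \<and> rho b a \<in> P"
      if "P \<in> {X\<^sub>1, X\<^sub>2}" "Q \<in> {X\<^sub>1, X\<^sub>2}" "a \<in> P" "b \<in> Q" for P Q a b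
    proof -
      have "restrict (brace_solution A) (X \<times> X) (a, b) \<in> Q \<times> P"
        using r that by blast
      moreover have "a \<in> X" "b \<in> X"
        using that un by auto
      ultimately show ?thesis
        by (simp add: brace_solution_eq)
    qed
    \<comment> \<open>Testing membership in \<open>X\<^sub>1\<close> alone suffices, as
      \<open>X\<^sub>2\<close> is its complement in the invariant set \<open>X\<close>. Equivalences
      rather than implications make closure under inverses immediate.\<close>
    define H where "H = {a \<in> carrier A. \<forall>b\<in>X. (lam a b \<in> X\<^sub>1 \<longleftrightarrow> b \<in> X\<^sub>1) \<and> (rho a b \<in> X\<^sub>1 \<longleftrightarrow> b \<in> X\<^sub>1)}"
    have "X \<subseteq> H"
    proof
      fix a assume a: "a \<in> X"
      then obtain P where P: "P \<in> {X\<^sub>1, X\<^sub>2}" "a \<in> P"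
        using un by blast
      have "(lam a b \<in> X\<^sub>1 \<longleftrightarrow> b \<in> X\<^sub>1) \<and> (rho a b \<in> X\<^sub>1 \<longleftrightarrow> b \<in> X\<^sub>1)" if "b \<in> X" for b
        \<comment> \<open>With \<open>a\<close> in the first position \<open>swap\<close> controls
          \<open>lam a b\<close>; with \<open>a\<close> in the second it controls
          \<open>rho a b\<close>.\<close>
        using swap[of P X\<^sub>1 a b] swap[of P X\<^sub>2 a b] swap[of X\<^sub>1 P b a] swap[of X\<^sub>2 P b a]
          P that un disj by blast
      then show "a \<in> H"
        using a XA by (auto simp: H_def)
    qed
    moreover have "subgroup H A"
    proof (rule circ.subgroupI)
      show "H \<subseteq> carrier A"
        by (auto simp: H_def)
      show "H \<noteq> {}"
        using \<open>X \<subseteq> H\<close> xX by blast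
    next
      fix a assume a: "a \<in> H"
      then have aA: "a \<in> carrier A"
        by (simp add: H_def)
      have "(lam (inv a) b \<in> X\<^sub>1 \<longleftrightarrow> b \<in> X\<^sub>1) \<and> (rho (inv a) b \<in> X\<^sub>1 \<longleftrightarrow> b \<in> X\<^sub>1)" if b: "b \<in> X" for b
      proof -
        have "lam (inv a) b \<in> X" "rho (inv a) b \<in> X"
          using aA b by (simp_all add: lamX rhoX)
        moreover have "b \<in> carrier A"
          using b XA by blast
        \<comment> \<open>To be used at \<open>c = lam (inv a) b\<close> and
          \<open>c = rho (inv a) b\<close>, which \<open>a\<close> sends back to
          \<open>b\<close>.\<close>
        moreover have "(lam a c \<in> X\<^sub>1 \<longleftrightarrow> c \<in> X\<^sub>1) \<and> (rho a c \<in> X\<^sub>1 \<longleftrightarrow> c \<in> X\<^sub>1)" if "c \<in> X" for c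
          using a that by (simp add: H_def)
        ultimately show ?thesis
          using aA by fastforce
      qed
      then show "inv a \<in> H"
        using aA by (simp add: H_def)
    next
      fix a b assume "a \<in> H" "b \<in> H"
      then show "a \<otimes> b \<in> H"
        using XA by (auto simp: H_def lam_circ rho_circ lamX rhoX subset_iff)
    qed
    ultimately have H: "carrier A \<subseteq> H"
      using generate circ.generate_subgroup_incl by blast
    \<comment> \<open>Each orbit step, including the inverse ones given by \<open>inv a\<close>, is
      the action of an element of \<open>H\<close>, so it never leaves the part that contains
      \<open>x\<close>.\<close>
    have "y \<in> X \<and> (y \<in> X\<^sub>1 \<longleftrightarrow> x \<in> X\<^sub>1)" if "y \<in> X" for y
      using that unfolding X_def
    proof induction
      case base
      then show ?case
        by (simp add: sol_orbit.base)
    next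
      case (sigma y a)
      then show ?case
        using H lamX by (auto simp: H_def sol_sigma_brace_solution X_def)
    next
      case (sigma_inv y a)
      then show ?case
        using H XA lamX[of "inv a" y] circ.inv_closed[of a]
        by (auto simp: H_def sol_sigma_brace_solution inv_into_lam subset_iff X_def)
    next
      case (tau y a)
      then show ?case
        using H rhoX by (auto simp: H_def sol_tau_brace_solution X_def)
    next
      case (tau_inv y a)
      then show ?case
        using H XA rhoX[of "inv a" y] circ.inv_closed[of a]
        by (auto simp: H_def sol_tau_brace_solution inv_into_rho subset_iff X_def)
    qed
    then show False
      using ne disj un by blast
  qed
  then show ?thesis
    unfolding indecomposable_solution_def X_def
    using nondegenerate_solution_sol_orbit[OF nondegenerate_brace_solution x] by blast
qed

section \<open>Passage to the generated sub skew left brace\<close>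

lemma skew_left_brace_sub:
  assumes "sub_skew_left_brace S A"
  shows "skew_left_brace (A\<lparr>carrier := S\<rparr>)"
proof -
  have S: "subgroup S (add_monoid A)" "subgroup S A"
    using assms by (auto simp: sub_skew_left_brace_def)
  have SA: "S \<subseteq> carrier A"
    using S(2) by (rule subgroup.subset)
  \<comment> \<open>Negation in the smaller record is computed relative to \<open>S\<close>, so it
    has to be identified with that of \<open>A\<close> before the brace law carries over.\<close>
  have neg: "\<ominus>\<^bsub>A\<lparr>carrier := S\<rparr>\<^esub> a = \<ominus> a" if "a \<in> S" for a
    using add.m_inv_consistent[OF S(1) that] by (simp add: a_inv_def)
  show ?thesis
  proof (intro skew_left_brace.intro skew_left_brace_axioms.intro)
    show "group (add_monoid (A\<lparr>carrier := S\<rparr>))"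
      using add.subgroup_imp_group[OF S(1)] by simp
    show "group (A\<lparr>carrier := S\<rparr>)"
      by (rule circ.subgroup_imp_group[OF S(2)])
  qed (use SA neg in \<open>auto simp: a_minus_def brace_distrib subset_iff\<close>)
qed

text \<open>This transfers the minimality of \<open>gen_brace_carrier\<close> from the ambient brace
  to the generated one, which therefore has no proper sub skew left brace containing the
  generator.\<close>

lemma sub_skew_left_brace_trans:
  assumes "sub_skew_left_brace S A" "sub_skew_left_brace T (A\<lparr>carrier := S\<rparr>)"
  shows "sub_skew_left_brace T A"
  using assms add.incl_subgroup[of S T] circ.incl_subgroup[of S T]
  by (simp add: sub_skew_left_brace_def)

end

theorem proposition6p5:
  fixes B :: "('a, 'm) ring_scheme" and x :: 'a
  assumes "skew_left_brace B" and "x \<in> carrier B"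
  defines "A \<equiv> gen_brace B x"
  defines "X \<equiv> sol_orbit (carrier A) (brace_solution A) x"
  shows "indecomposable_solution X (restrict (brace_solution A) (X \<times> X))"
proof -
  interpret B: skew_left_brace B by (rule assms(1))
  note least = B.gen_brace_carrier_least[OF assms(2)]
  interpret A: skew_left_brace A
    unfolding A_def gen_brace_def by (rule B.skew_left_brace_sub[OF least(1)])
  have "carrier A \<subseteq> S" if "sub_skew_left_brace S A" "x \<in> S" for S
    using that least(3)[OF B.sub_skew_left_brace_trans[OF least(1), of S]]
    by (simp add: A_def gen_brace_def)
  moreover have "x \<in> carrier A"
    using least(2) by (simp add: A_def gen_brace_def)
  ultimately show ?thesis
    unfolding X_def by (intro A.indecomposable_orbit)
qed

end
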